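(* Let $m_2\ne0$ be a real number. Consider the system for forms $\overset{r}{\omega}\in K^r(4)$, $r=0,1,2,3,4$: $$-\delta^c\overset{1}{\omega}=0,\quad d^c\overset{0}{\omega}-\delta^c\overset{2}{\omega}=m_2\overset{1}{\omega},\quad d^c\overset{1}{\omega}-\delta^c\overset{3}{\omega}=0,\quad d^c\overset{2}{\omega}-\delta^c\overset{4}{\omega}=m_2\overset{3}{\omega},\quad d^c\overset{3}{\omega}=0.$$ This system is invariant under the transformation $$\overset{0}{\omega}\to\overset{0}{\omega}-\delta^c\overset{1}{\varphi},\qquad \overset{2}{\omega}\to\overset{2}{\omega}+d^c\overset{1}{\varphi}-\delta^c\overset{3}{\varphi},\qquad \overset{4}{\omega}\to\overset{4}{\omega}+d^c\overset{3}{\varphi}$$ (with $\overset{1}{\omega},\overset{3}{\omega}$ unchanged), where the gauge forms $\overset{1}{\varphi}\in K^1(4)$ and $\overset{3}{\varphi}\in K^3(4)$ satisfy $\Delta^c\overset{1}{\varphi}=0$ and $\Delta^c\overset{3}{\varphi}=0$. That is, for all such gauge forms, $(\overset{0}{\omega},\overset{1}{\omega},\overset{2}{\omega},\overset{3}{\omega},\overset{4}{\omega})$ is a solution of the system if and only if $(\overset{0}{\omega}-\delta^c\overset{1}{\varphi},\ \overset{1}{\omega},\ \overset{2}{\omega}+d^c\overset{1}{\varphi}-\delta^c\overset{3}{\varphi},\ \overset{3}{\omega},\ \overset{4}{\omega}+d^c\overset{3}{\varphi})$ is.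
   Context: Chains. Let $C=C^0\oplus C^1$, where $C^0$ is the real vector space with basis $x_\kappa$ ($\kappa\in\mathbb Z$) and $C^1$ the real vector space with basis $e_\kappa$ ($\kappa\in\mathbb Z$); put $\tau\kappa=\kappa+1$, $\partial x_\kappa=0$, $\partial e_\kappa=x_{\tau\kappa}-x_\kappa$. Let $C(4)=C\otimes C\otimes C\otimes C$, with basis elements $s_k=s_{k_0}\otimes s_{k_1}\otimes s_{k_2}\otimes s_{k_3}$, $k=(k_0,k_1,k_2,k_3)\in\mathbb Z^4$, each $s_{k_i}$ being $x_{k_i}$ or $e_{k_i}$; the dimension of $s_k$ is the number of factors of type $e$. The boundary is extended by $\partial(a\otimes b)=\partial a\otimes b+(-1)^{\dim a}a\otimes\partial b$ and linearity. Cochains (discrete forms). $K(4)=K\otimes K\otimes K\otimes K$ is the dual complex of real cochains, with basis elements $s^k=s^{k_0}\otimes s^{k_1}\otimes s^{k_2}\otimes s^{k_3}$, each $s^{k_i}$ being $x^{k_i}$ or $e^{k_i}$. Forms are (possibly infinite) formal real linear combinations of basis elements. The pairing is $\langle \varepsilon_k,s^k\rangle=1$ if $\varepsilon_k=s_k$ is the corresponding basis chain and $0$ otherwise, extended linearly. $K^r(4)$ is the space of forms of degree $r$, $K(4)=\bigoplus_{r=0}^4K^r(4)$. The coboundary $d^c:K^r(4)\to K^{r+1}(4)$ is defined by $\langle\partial a,\omega\rangle=\langle a,d^c\omega\rangle$ for all $(r+1)$-chains $a$; $d^c\omega=0$ for $\omega\in K^4(4)$. Cup product. On $K$: $x^\kappa\cup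 x^\kappa=x^\kappa$, $e^\kappa\cup x^{\tau\kappa}=e^\kappa$, $x^\kappa\cup e^\kappa=e^\kappa$, and all other products of basis elements are $0$. Inductively, for basis elements $s_{(p)},s_{(q)}$ of the $n$-fold tensor product of $K$ (of degrees $p,q$) and basis elements $s^\kappa,s^\mu$ of $K$, $(s_{(p)}\otimes s^\kappa)\cup(s_{(q)}\otimes s^\mu)=Q(\kappa,q)\,(s_{(p)}\cup s_{(q)})\otimes(s^\kappa\cup s^\mu)$, where $Q(\kappa,q)=-1$ if both $s^\kappa$ and $s_{(q)}$ have odd degree and $Q(\kappa,q)=+1$ otherwise. Extend linearly. Star operator (Lorentz signature). $\ast:K^r(4)\to K^{4-r}(4)$ is the linear bijection sending a basis element $s^k$ to the unique element of the form $\pm$(basis element) with $s^k\cup\ast s^k=Q(k_0)e^k$, where $e^k=e^{k_0}\otimes e^{k_1}\otimes e^{k_2}\otimes e^{k_3}$, $Q(k_0)=+1$ if $s^{k_0}=x^{k_0}$ and $Q(k_0)=-1$ if $s^{k_0}=e^{k_0}$ (so, up to sign, $\ast$ replaces each factor $x^{k_i}$ by $e^{k_i}$ and each factor $e^{k_i}$ by $x^{\tau k_i}$). Codifferential and Laplacian. $\delta^c:K^{r+1}(4)\to K^r(4)$, $\delta^c\psi=(-1)^{r+1}\ast^{-1}d^c\ast\psi$ for $\psi\in K^{r+1}(4)$, $r=0,1,2,3$; $\delta^c\omega=0$ for $\omega\in K^0(4)$. $\Delta^c=-(d^c\delta^c+\delta^cd^c):K^r(4)\to K^r(4)$. *)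

theory Defs
  imports Complex_Main "HOL-Library.Function_Algebras" "HOL-Library.Poly_Mapping"
begin

section \<open>Basis elements and their tensor products\<close>

text \<open>
  A chain basis element and the dual cochain basis element carry the same label, so
  \<^term>\<open>X k\<close> stands both for \<open>x\<^sub>k\<close> and for \<open>x\<^sup>k\<close>, and \<^term>\<open>E k\<close> both for \<open>e\<^sub>k\<close> and for \<open>e\<^sup>k\<close>.
  A label for a basis element \<open>s \<otimes> t\<close> of a tensor product is the pair of labels.  Chains over the
  labels \<open>'a\<close> are the finitely supported functions \<open>'a \<Rightarrow>\<^sub>0 real\<close>; forms are possibly infinite
  formal linear combinations, that is, arbitrary functions \<open>'a \<Rightarrow> real\<close>.
\<close>

datatype cell = X (idx: int) | E (idx: int)

type_synonym cell4 = "((cell \<times> cell) \<times> cell) \<times> cell"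

definition base_form :: "'a \<Rightarrow> ('a \<Rightarrow> real)" where
  "base_form s = (\<lambda>t. of_bool (t = s))"

definition scale_form :: "real \<Rightarrow> ('a \<Rightarrow> real) \<Rightarrow> ('a \<Rightarrow> real)" where
  "scale_form c \<omega> = (\<lambda>s. c * \<omega> s)"

definition tensor_form :: "('a \<Rightarrow> real) \<Rightarrow> ('b \<Rightarrow> real) \<Rightarrow> ('a \<times> 'b \<Rightarrow> real)" where
  "tensor_form \<omega> \<eta> = (\<lambda>(s, t). \<omega> s * \<eta> t)"

definition scale_chain :: "real \<Rightarrow> ('a \<Rightarrow>\<^sub>0 real) \<Rightarrow> ('a \<Rightarrow>\<^sub>0 real)" where
  "scale_chain c a = Poly_Mapping.map ((*) c) a"

definition tensor_chain :: "('a \<Rightarrow>\<^sub>0 real) \<Rightarrow> ('b \<Rightarrow>\<^sub>0 real) \<Rightarrow> ('a \<times> 'b \<Rightarrow>\<^sub>0 real)" where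
  "tensor_chain a b = (\<Sum>s\<in>Poly_Mapping.keys a. \<Sum>t\<in>Poly_Mapping.keys b.
     Poly_Mapping.single (s, t) (Poly_Mapping.lookup a s * Poly_Mapping.lookup b t))"

text \<open>
  The type class only serves to define dimension, boundary and cup product of basis elements
  by recursion over tensor products.
\<close>

class tensor_basis =
  fixes cdim :: "'a \<Rightarrow> nat"
    and bd :: "'a \<Rightarrow> ('a \<Rightarrow>\<^sub>0 real)"
    and cup_base :: "'a \<Rightarrow> 'a \<Rightarrow> ('a \<Rightarrow> real)"

instantiation cell :: tensor_basis
begin

fun cdim_cell :: "cell \<Rightarrow> nat" where
  "cdim_cell (X k) = 0"
| "cdim_cell (E k) = 1"

fun bd_cell :: "cell \<Rightarrow> (cell \<Rightarrow>\<^sub>0 real)" where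
  "bd_cell (X k) = 0"
| "bd_cell (E k) = Poly_Mapping.single (X (k + 1)) 1 - Poly_Mapping.single (X k) 1"

fun cup_base_cell :: "cell \<Rightarrow> cell \<Rightarrow> (cell \<Rightarrow> real)" where
  "cup_base_cell (X k) (X j) = (if j = k then base_form (X k) else 0)"
| "cup_base_cell (E k) (X j) = (if j = k + 1 then base_form (E k) else 0)"
| "cup_base_cell (X k) (E j) = (if j = k then base_form (E k) else 0)"
| "cup_base_cell (E k) (E j) = 0"

instance ..

end

instantiation prod :: (tensor_basis, tensor_basis) tensor_basis
begin

fun cdim_prod :: "'a \<times> 'b \<Rightarrow> nat" where
  "cdim_prod (s, t) = cdim s + cdim t"

fun bd_prod :: "'a \<times> 'b \<Rightarrow> ('a \<times> 'b \<Rightarrow>\<^sub>0 real)" where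
  "bd_prod (s, t) = tensor_chain (bd s) (Poly_Mapping.single t 1)
     + scale_chain ((-1) ^ cdim s) (tensor_chain (Poly_Mapping.single s 1) (bd t))"

fun cup_base_prod :: "'a \<times> 'b \<Rightarrow> 'a \<times> 'b \<Rightarrow> ('a \<times> 'b \<Rightarrow> real)" where
  "cup_base_prod (s, u) (t, v) =
     scale_form (if odd (cdim u) \<and> odd (cdim t) then -1 else 1)
       (tensor_form (cup_base s t) (cup_base u v))"

instance ..

end


section \<open>Linear extensions\<close>

definition boundary :: "('a::tensor_basis \<Rightarrow>\<^sub>0 real) \<Rightarrow> ('a \<Rightarrow>\<^sub>0 real)" where
  "boundary a = (\<Sum>s\<in>Poly_Mapping.keys a. scale_chain (Poly_Mapping.lookup a s) (bd s))"

definition pairing :: "('a \<Rightarrow>\<^sub>0 real) \<Rightarrow> ('a \<Rightarrow> real) \<Rightarrow> real" where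
  "pairing a \<omega> = (\<Sum>s\<in>Poly_Mapping.keys a. Poly_Mapping.lookup a s * \<omega> s)"

text \<open>
  For infinite forms the extension is made coefficientwise.  The index set below is finite
  for the label types in use, see \<open>finite_cup_base\<close>.
\<close>

definition cup :: "('a::tensor_basis \<Rightarrow> real) \<Rightarrow> ('a \<Rightarrow> real) \<Rightarrow> ('a \<Rightarrow> real)" where
  "cup \<omega> \<eta> = (\<lambda>l. \<Sum>(s, t)\<in>{(s, t). cup_base s t l \<noteq> 0}. \<omega> s * \<eta> t * cup_base s t l)"

definition forms :: "nat \<Rightarrow> (cell4 \<Rightarrow> real) set" where
  "forms r = {\<omega>. \<forall>s. \<omega> s \<noteq> 0 \<longrightarrow> cdim s = r}"

definition chains :: "nat \<Rightarrow> (cell4 \<Rightarrow>\<^sub>0 real) set" where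
  "chains r = {a. \<forall>s\<in>Poly_Mapping.keys a. cdim s = r}"


section \<open>Coboundary, star, codifferential and Laplacian\<close>

text \<open>
  The coboundary is defined at once on all of \<open>K(4)\<close>, by duality with all chains.
  On \<^term>\<open>forms r\<close> it is the map to \<^term>\<open>forms (Suc r)\<close> characterised by duality with the
  chains of dimension \<open>r + 1\<close>, see \<open>dc_in_forms\<close>, \<open>dc_eqI\<close> and \<open>dc_top\<close>.
\<close>

definition dc :: "(cell4 \<Rightarrow> real) \<Rightarrow> (cell4 \<Rightarrow> real)" where
  "dc \<omega> = (THE \<eta>. \<forall>a. pairing (boundary a) \<omega> = pairing a \<eta>)"

fun vol :: "cell4 \<Rightarrow> cell4" where
  "vol (((s0, s1), s2), s3) = (((E (idx s0), E (idx s1)), E (idx s2)), E (idx s3))"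

fun lorentz_sign :: "cell4 \<Rightarrow> real" where
  "lorentz_sign (((X k, s1), s2), s3) = 1"
| "lorentz_sign (((E k, s1), s2), s3) = -1"

definition star_base :: "cell4 \<Rightarrow> (cell4 \<Rightarrow> real)" where
  "star_base s = (THE \<eta>. (\<exists>t. \<eta> = base_form t \<or> \<eta> = - base_form t) \<and>
     cup (base_form s) \<eta> = scale_form (lorentz_sign s) (base_form (vol s)))"

text \<open>Again a coefficientwise extension; the index set is a singleton, see \<open>star_apply\<close>.\<close>

definition star :: "(cell4 \<Rightarrow> real) \<Rightarrow> (cell4 \<Rightarrow> real)" where
  "star \<omega> = (\<lambda>l. \<Sum>s\<in>{s. star_base s l \<noteq> 0}. \<omega> s * star_base s l)"

text \<open>
  The natural number argument of the next two operators is the degree of the form they are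
  applied to.
\<close>

fun codiff :: "nat \<Rightarrow> (cell4 \<Rightarrow> real) \<Rightarrow> (cell4 \<Rightarrow> real)" where
  "codiff 0 \<psi> = 0"
| "codiff (Suc r) \<psi> = scale_form ((-1) ^ (r + 1)) (inv star (dc (star \<psi>)))"

definition laplacian :: "nat \<Rightarrow> (cell4 \<Rightarrow> real) \<Rightarrow> (cell4 \<Rightarrow> real)" where
  "laplacian r \<omega> = - (dc (codiff r \<omega>) + codiff (Suc r) (dc \<omega>))"

definition is_solution ::
  "real \<Rightarrow> (cell4 \<Rightarrow> real) \<Rightarrow> (cell4 \<Rightarrow> real) \<Rightarrow> (cell4 \<Rightarrow> real) \<Rightarrow> (cell4 \<Rightarrow> real) \<Rightarrow> (cell4 \<Rightarrow> real) \<Rightarrow> bool"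
where
  "is_solution m \<omega>0 \<omega>1 \<omega>2 \<omega>3 \<omega>4 \<longleftrightarrow>
     \<omega>0 \<in> forms 0 \<and> \<omega>1 \<in> forms 1 \<and> \<omega>2 \<in> forms 2 \<and> \<omega>3 \<in> forms 3 \<and> \<omega>4 \<in> forms 4 \<and>
     - codiff 1 \<omega>1 = 0 \<and>
     dc \<omega>0 - codiff 2 \<omega>2 = scale_form m \<omega>1 \<and>
     dc \<omega>1 - codiff 3 \<omega>3 = 0 \<and>
     dc \<omega>2 - codiff 4 \<omega>4 = scale_form m \<omega>3 \<and>
     dc \<omega>3 = 0"


section \<open>Well-definedness\<close>

subsection \<open>Coboundary\<close>

lemma lookup_scale_chain [simp]:
  "Poly_Mapping.lookup (scale_chain c a) s = c * Poly_Mapping.lookup a s"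
  by (simp add: scale_chain_def Poly_Mapping.map.rep_eq when_def)

lemma keys_scale_chain: "Poly_Mapping.keys (scale_chain c a) \<subseteq> Poly_Mapping.keys a"
  by (auto simp: in_keys_iff)

lemma pairing_superset:
  assumes "finite A" "Poly_Mapping.keys a \<subseteq> A"
  shows "pairing a \<omega> = (\<Sum>s\<in>A. Poly_Mapping.lookup a s * \<omega> s)"
  unfolding pairing_def
  by (rule sum.mono_neutral_left) (use assms in \<open>auto simp: in_keys_iff\<close>)

lemma pairing_single: "pairing (Poly_Mapping.single s c) \<omega> = c * \<omega> s"
  by (subst pairing_superset[of "{s}"]) (auto simp: in_keys_iff)

lemma pairing_scale: "pairing (scale_chain c a) \<omega> = c * pairing a \<omega>"
  by (subst pairing_superset[OF finite_keys keys_scale_chain])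
     (simp add: pairing_def sum_distrib_left mult.assoc)

lemma pairing_zero: "pairing 0 \<omega> = 0"
  by (simp add: pairing_def)

lemma pairing_add: "pairing (a + b) \<omega> = pairing a \<omega> + pairing b \<omega>"
proof -
  let ?A = "Poly_Mapping.keys a \<union> Poly_Mapping.keys b"
  have "Poly_Mapping.keys (a + b) \<subseteq> ?A" by (rule keys_add)
  then show ?thesis
    by (simp add: pairing_superset[of ?A] lookup_add sum.distrib distrib_right)
qed

lemma pairing_sum: "finite I \<Longrightarrow> pairing (\<Sum>i\<in>I. f i) \<omega> = (\<Sum>i\<in>I. pairing (f i) \<omega>)"
  by (induction I rule: finite_induct) (auto simp: pairing_zero pairing_add)

lemma pairing_boundary: "pairing (boundary a) \<omega> = pairing a (\<lambda>s. pairing (bd s) \<omega>)"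
  by (simp add: boundary_def pairing_sum pairing_scale) (simp add: pairing_def)

lemma boundary_single: "boundary (Poly_Mapping.single s 1) = bd s"
  by (simp add: boundary_def poly_mapping_eq_iff fun_eq_iff)

lemma dc_apply: "dc \<omega> = (\<lambda>s. pairing (bd s) \<omega>)"
  unfolding dc_def
proof (rule the_equality)
  fix \<eta> assume "\<forall>a. pairing (boundary a) \<omega> = pairing a \<eta>"
  then have "pairing (boundary (Poly_Mapping.single s 1)) \<omega> = pairing (Poly_Mapping.single s 1) \<eta>" for s
    by blast
  then show "\<eta> = (\<lambda>s. pairing (bd s) \<omega>)"
    by (simp add: fun_eq_iff boundary_single pairing_single)
qed (simp add: pairing_boundary)

lemma dc_dual: "pairing (boundary a) \<omega> = pairing a (dc \<omega>)"
  by (simp add: dc_apply pairing_boundary)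

lemma cdim_bd_cell: "t \<in> Poly_Mapping.keys (bd (s :: cell)) \<Longrightarrow> Suc (cdim t) = cdim s"
  by (cases s) (auto simp: in_keys_iff lookup_minus lookup_single when_def split: if_splits)

lemma keys_tensor_chain:
  "Poly_Mapping.keys (tensor_chain a b) \<subseteq> Poly_Mapping.keys a \<times> Poly_Mapping.keys b"
proof
  fix p assume "p \<in> Poly_Mapping.keys (tensor_chain a b)"
  then obtain s where s: "s \<in> Poly_Mapping.keys a"
    "p \<in> Poly_Mapping.keys (\<Sum>t\<in>Poly_Mapping.keys b.
       Poly_Mapping.single (s, t) (Poly_Mapping.lookup a s * Poly_Mapping.lookup b t))"
    unfolding tensor_chain_def using subsetD[OF keys_sum] by fast
  then obtain t where "t \<in> Poly_Mapping.keys b"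
    "p \<in> Poly_Mapping.keys (Poly_Mapping.single (s, t) (Poly_Mapping.lookup a s * Poly_Mapping.lookup b t))"
    using subsetD[OF keys_sum] by fast
  with s show "p \<in> Poly_Mapping.keys a \<times> Poly_Mapping.keys b"
    by (simp add: keys_single split: if_splits)
qed

lemma cdim_bd_prod:
  fixes s :: "'a::tensor_basis \<times> 'b::tensor_basis"
  assumes a: "\<And>(u::'a) v. v \<in> Poly_Mapping.keys (bd u) \<Longrightarrow> Suc (cdim v) = cdim u"
    and b: "\<And>(u::'b) v. v \<in> Poly_Mapping.keys (bd u) \<Longrightarrow> Suc (cdim v) = cdim u"
    and t: "t \<in> Poly_Mapping.keys (bd s)"
  shows "Suc (cdim t) = cdim s"
proof -
  obtain s1 s2 t1 t2 where [simp]: "s = (s1, s2)" "t = (t1, t2)" by (cases s, cases t)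
  have "t \<in> Poly_Mapping.keys (bd s1) \<times> {s2} \<union> {s1} \<times> Poly_Mapping.keys (bd s2)"
  proof -
    have "t \<in> Poly_Mapping.keys (tensor_chain (bd s1) (Poly_Mapping.single s2 1)) \<union>
        Poly_Mapping.keys (scale_chain ((-1) ^ cdim s1) (tensor_chain (Poly_Mapping.single s1 1) (bd s2)))"
      using t keys_add unfolding \<open>s = _\<close> bd_prod.simps by (rule subsetD[rotated])
    moreover have "Poly_Mapping.keys (tensor_chain (bd s1) (Poly_Mapping.single s2 1)) \<subseteq>
        Poly_Mapping.keys (bd s1) \<times> {s2}"
      using keys_tensor_chain[of "bd s1" "Poly_Mapping.single s2 1"] by simp
    moreover have "Poly_Mapping.keys (scale_chain ((-1) ^ cdim s1) (tensor_chain (Poly_Mapping.single s1 1) (bd s2)))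
        \<subseteq> {s1} \<times> Poly_Mapping.keys (bd s2)"
      using order.trans[OF keys_scale_chain keys_tensor_chain[of "Poly_Mapping.single s1 1" "bd s2"]] by simp
    ultimately show ?thesis by blast
  qed
  then show ?thesis using a[of t1 s1] b[of t2 s2] by auto
qed

lemma cdim_bd:
  assumes "t \<in> Poly_Mapping.keys (bd (s :: cell4))"
  shows "Suc (cdim t) = cdim s"
proof -
  have 2: "Suc (cdim v) = cdim u" if "v \<in> Poly_Mapping.keys (bd u)" for u v :: "cell \<times> cell"
    using cdim_bd_cell cdim_bd_cell that by (rule cdim_bd_prod)
  have 3: "Suc (cdim v) = cdim u" if "v \<in> Poly_Mapping.keys (bd u)" for u v :: "(cell \<times> cell) \<times> cell"
    using 2 cdim_bd_cell that by (rule cdim_bd_prod)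
  show ?thesis
    using 3 cdim_bd_cell assms by (rule cdim_bd_prod)
qed

lemma formsD: "\<omega> \<in> forms r \<Longrightarrow> \<omega> s \<noteq> 0 \<Longrightarrow> cdim s = r"
  unfolding forms_def by blast

lemma formsI: "(\<And>s. \<omega> s \<noteq> 0 \<Longrightarrow> cdim s = r) \<Longrightarrow> \<omega> \<in> forms r"
  unfolding forms_def by blast

lemma dc_in_forms:
  assumes "\<omega> \<in> forms r"
  shows "dc \<omega> \<in> forms (Suc r)"
proof -
  have "cdim s = Suc r" if nz: "dc \<omega> s \<noteq> 0" for s
  proof -
    obtain t where "t \<in> Poly_Mapping.keys (bd s)" "\<omega> t \<noteq> 0"
      using nz unfolding dc_apply pairing_def by (auto elim: sum.not_neutral_contains_not_neutral)
    then show ?thesis using cdim_bd[of t s] formsD[OF assms] by simp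
  qed
  then show ?thesis by (rule formsI)
qed

lemma dc_eqI:
  assumes "\<omega> \<in> forms r" "\<eta> \<in> forms (Suc r)"
    and dual: "\<And>a. a \<in> chains (Suc r) \<Longrightarrow> pairing (boundary a) \<omega> = pairing a \<eta>"
  shows "\<eta> = dc \<omega>"
proof
  fix s
  show "\<eta> s = dc \<omega> s"
  proof (cases "cdim s = Suc r")
    case True
    then show ?thesis using dual[of "Poly_Mapping.single s 1"]
      by (simp add: chains_def dc_dual pairing_single)
  next
    case False
    then show ?thesis using formsD[OF assms(2)] formsD[OF dc_in_forms[OF assms(1)]] by metis
  qed
qed

lemma cdim_le_4: "cdim (s :: cell4) \<le> 4"
proof -
  have c: "cdim c \<le> 1" for c :: cell by (cases c) auto
  obtain s0 s1 s2 s3 where "s = (((s0, s1), s2), s3)" by (metis surj_pair)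
  then show ?thesis using c[of s0] c[of s1] c[of s2] c[of s3] by simp
qed

lemma dc_top: "\<omega> \<in> forms 4 \<Longrightarrow> dc \<omega> = 0"
proof
  fix s assume "\<omega> \<in> forms 4"
  then show "dc \<omega> s = 0 s"
    using formsD[OF dc_in_forms, of \<omega> 4 s] cdim_le_4[of s] by force
qed


subsection \<open>Cup product and star\<close>

lemma finite_cup_base_cell: "finite {(s, t). cup_base s t (l :: cell) \<noteq> 0}"
proof (rule finite_subset)
  let ?k = "idx l"
  show "{(s, t). cup_base s t l \<noteq> 0} \<subseteq> {X ?k, E ?k} \<times> {X ?k, X (?k + 1), E ?k}"
  proof clarify
    fix s t assume "cup_base s t l \<noteq> 0"
    then show "s \<in> {X ?k, E ?k} \<and> t \<in> {X ?k, X (?k + 1), E ?k}"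
      by (cases s; cases t) (auto simp: base_form_def split: if_splits)
  qed
qed auto

lemma finite_cup_base_prod:
  fixes l :: "'a::tensor_basis \<times> 'b::tensor_basis"
  assumes a: "\<And>l::'a. finite {(s, t). cup_base s t l \<noteq> 0}"
    and b: "\<And>l::'b. finite {(s, t). cup_base s t l \<noteq> 0}"
  shows "finite {(s, t). cup_base s t l \<noteq> 0}"
proof -
  obtain l1 l2 where l: "l = (l1, l2)" by (cases l)
  let ?f = "\<lambda>((s, t), (u, v)). ((s, u), (t, v))"
  have "{(s, t). cup_base s t l \<noteq> 0} \<subseteq>
      ?f ` ({(s, t). cup_base s t l1 \<noteq> 0} \<times> {(s, t). cup_base s t l2 \<noteq> 0})"
    by (force simp: l scale_form_def tensor_form_def image_iff)
  then show ?thesis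
    by (rule finite_subset) (intro finite_imageI finite_cartesian_product a b)
qed

lemma finite_cup_base: "finite {(s, t). cup_base s t (l :: cell4) \<noteq> 0}"
  by (intro finite_cup_base_prod finite_cup_base_cell)

lemma cup_base_form: "cup (base_form s) (scale_form c (base_form t)) = scale_form c (cup_base s (t :: cell4))"
proof
  fix l :: cell4
  let ?A = "{(s, t). cup_base s t l \<noteq> 0}"
  have "cup (base_form s) (scale_form c (base_form t)) l =
      (\<Sum>p\<in>?A. if p = (s, t) then c * cup_base s t l else 0)"
    unfolding cup_def
    by (rule sum.cong) (auto simp: base_form_def scale_form_def split: if_splits)
  also have "\<dots> = scale_form c (cup_base s t) l"
    by (simp add: finite_cup_base scale_form_def)
  finally show "cup (base_form s) (scale_form c (base_form t)) l = scale_form c (cup_base s t) l" .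
qed

fun flip :: "cell \<Rightarrow> cell" where
  "flip (X k) = E k"
| "flip (E k) = X (k + 1)"

fun flip4 :: "cell4 \<Rightarrow> cell4" where
  "flip4 (((s0, s1), s2), s3) = (((flip s0, flip s1), flip s2), flip s3)"

lemma cup_flip: "cup_base s (flip s) = base_form (E (idx s))"
  by (cases s) auto

lemma cup_vol_cell: "cup_base s t (E (idx s)) \<noteq> 0 \<Longrightarrow> t = flip s"
  by (cases s; cases t) (auto simp: base_form_def split: if_splits)

lemma cup_vol: "cup_base s t (vol s) \<noteq> 0 \<Longrightarrow> t = flip4 s"
  by (cases s rule: flip4.cases; cases t rule: flip4.cases)
     (auto simp: scale_form_def tensor_form_def dest: cup_vol_cell)

lemma cup_base_prod_sign:
  assumes "\<exists>c\<in>{1, -1}. cup_base s t = scale_form c (base_form a)"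
    and "\<exists>c\<in>{1, -1}. cup_base u v = scale_form c (base_form b)"
  shows "\<exists>c\<in>{1, -1}. cup_base (s, u) (t, v) = scale_form c (base_form (a, b))"
proof -
  obtain c d where cd: "c \<in> {1, -1}" "d \<in> {1, -1}"
    and eq: "cup_base s t = scale_form c (base_form a)" "cup_base u v = scale_form d (base_form b)"
    using assms by blast
  define e :: real where "e = (if odd (cdim u) \<and> odd (cdim t) then -1 else 1)"
  have "cup_base (s, u) (t, v) = scale_form (e * c * d) (base_form (a, b))"
    unfolding cup_base_prod.simps eq e_def[symmetric]
    by (auto simp: scale_form_def tensor_form_def base_form_def)
  moreover have "e * c * d \<in> {1, -1}" using cd by (auto simp: e_def)
  ultimately show ?thesis by blast
qed

lemma cup_flip4: "\<exists>c\<in>{1, -1}. cup_base s (flip4 s) = scale_form c (base_form (vol s))"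
proof -
  obtain s0 s1 s2 s3 where s: "s = (((s0, s1), s2), s3)" by (cases s rule: flip4.cases)
  have "\<exists>c\<in>{1, -1}. cup_base k (flip k) = scale_form c (base_form (E (idx k)))" for k
    by (rule bexI[of _ 1]) (simp_all add: cup_flip scale_form_def)
  then show ?thesis
    unfolding s flip4.simps vol.simps by (intro cup_base_prod_sign) blast+
qed

definition star_sign :: "cell4 \<Rightarrow> real" where
  "star_sign s = lorentz_sign s * cup_base s (flip4 s) (vol s)"

lemma star_sign_cases: "star_sign s = 1 \<or> star_sign s = -1"
proof -
  have "lorentz_sign s = 1 \<or> lorentz_sign s = -1" by (cases s rule: lorentz_sign.cases) auto
  then show ?thesis
    using cup_flip4[of s] by (auto simp: star_sign_def scale_form_def base_form_def)
qed

lemma star_base_eq: "star_base s = scale_form (star_sign s) (base_form (flip4 s))"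
  unfolding star_base_def
proof (rule the_equality)
  obtain c where c: "c = 1 \<or> c = -1" "cup_base s (flip4 s) = scale_form c (base_form (vol s))"
    using cup_flip4[of s] by blast
  then have sc: "star_sign s = lorentz_sign s * c"
    by (simp add: star_sign_def scale_form_def base_form_def)
  have "star_sign s * c = lorentz_sign s" using c(1) by (auto simp: sc)
  then have "cup (base_form s) (scale_form (star_sign s) (base_form (flip4 s))) =
      scale_form (lorentz_sign s) (base_form (vol s))"
    unfolding cup_base_form c(2) by (simp add: scale_form_def flip: mult.assoc)
  moreover have "\<exists>t. scale_form (star_sign s) (base_form (flip4 s)) = base_form t \<or>
      scale_form (star_sign s) (base_form (flip4 s)) = - base_form t"
    by (rule exI[of _ "flip4 s"]) (use star_sign_cases[of s] in \<open>auto simp: scale_form_def fun_eq_iff\<close>)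
  ultimately show "(\<exists>t. scale_form (star_sign s) (base_form (flip4 s)) = base_form t \<or>
      scale_form (star_sign s) (base_form (flip4 s)) = - base_form t) \<and>
      cup (base_form s) (scale_form (star_sign s) (base_form (flip4 s))) =
      scale_form (lorentz_sign s) (base_form (vol s))" by blast
next
  fix \<eta> assume \<eta>: "(\<exists>t. \<eta> = base_form t \<or> \<eta> = - base_form t) \<and>
      cup (base_form s) \<eta> = scale_form (lorentz_sign s) (base_form (vol s))"
  have "base_form t = scale_form 1 (base_form t)" "- base_form t = scale_form (-1) (base_form t)" for t :: cell4
    by (simp_all add: scale_form_def fun_eq_iff)
  with \<eta> obtain t c where t: "c = 1 \<or> c = -1" "\<eta> = scale_form c (base_form t)"
    by metis
  have l: "lorentz_sign s = 1 \<or> lorentz_sign s = -1" by (cases s rule: lorentz_sign.cases) auto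
  have "scale_form c (cup_base s t) = scale_form (lorentz_sign s) (base_form (vol s))"
    using \<eta> by (simp add: t cup_base_form)
  then have eq: "c * cup_base s t (vol s) = lorentz_sign s"
    by (auto simp: scale_form_def base_form_def dest: fun_cong[of _ _ "vol s"])
  then have tf: "t = flip4 s" using l by (intro cup_vol) auto
  have "cup_base s (flip4 s) (vol s) * cup_base s (flip4 s) (vol s) = 1"
    using cup_flip4[of s] by (auto simp: scale_form_def base_form_def)
  then have "c = star_sign s"
    using eq unfolding tf star_sign_def by (metis mult.assoc mult.right_neutral)
  then show "\<eta> = scale_form (star_sign s) (base_form (flip4 s))"
    by (simp add: t tf)
qed

fun unflip :: "cell \<Rightarrow> cell" where
  "unflip (E k) = X k"
| "unflip (X k) = E (k - 1)"

fun unflip4 :: "cell4 \<Rightarrow> cell4" where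
  "unflip4 (((s0, s1), s2), s3) = (((unflip s0, unflip s1), unflip s2), unflip s3)"

lemma flip_unflip: "flip (unflip s) = s" "unflip (flip s) = s"
  by (cases s; simp)+

lemma flip4_unflip4 [simp]: "flip4 (unflip4 s) = s" "unflip4 (flip4 s) = s"
  by (cases s rule: flip4.cases; simp add: flip_unflip)+

lemma star_apply: "star \<omega> l = star_sign (unflip4 l) * \<omega> (unflip4 l)"
proof -
  have "star_sign s \<noteq> 0" for s using star_sign_cases[of s] by auto
  then have "{s. star_base s l \<noteq> 0} = {unflip4 l}"
    by (auto simp: star_base_eq scale_form_def base_form_def simp del: flip4.simps unflip4.simps split_paired_All)
  then show ?thesis by (simp add: star_def star_base_eq scale_form_def base_form_def)
qed

lemma star_sign_square [simp]: "star_sign s * star_sign s = 1"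
  using star_sign_cases[of s] by auto

lemma bij_star: "bij star"
proof (rule o_bij[where g = "\<lambda>\<omega> s. star_sign s * \<omega> (flip4 s)"])
  show "(\<lambda>\<omega> s. star_sign s * \<omega> (flip4 s)) \<circ> star = id"
    by (simp add: fun_eq_iff star_apply flip: mult.assoc)
  show "star \<circ> (\<lambda>\<omega> s. star_sign s * \<omega> (flip4 s)) = id"
    by (simp add: fun_eq_iff star_apply flip: mult.assoc)
qed

lemma star_in_forms_iff:
  assumes "r \<le> 4"
  shows "star \<omega> \<in> forms (4 - r) \<longleftrightarrow> \<omega> \<in> forms r"
proof -
  have c: "cdim (flip s) + cdim s = 1" for s by (cases s) auto
  have d: "cdim (flip4 s) + cdim s = 4" for s
  proof (cases s rule: flip4.cases)
    case (1 s0 s1 s2 s3)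
    then show ?thesis using c[of s0] c[of s1] c[of s2] c[of s3] by simp
  qed
  have nz: "star_sign s \<noteq> 0" for s using star_sign_cases[of s] by auto
  have eq: "cdim (flip4 s) = 4 - r \<longleftrightarrow> cdim s = r" for s using d[of s] assms by linarith
  have star_nz: "star \<omega> (flip4 s) \<noteq> 0 \<longleftrightarrow> \<omega> s \<noteq> 0" for s
    by (simp only: star_apply flip4_unflip4) (simp add: nz)
  show ?thesis
  proof
    assume *: "star \<omega> \<in> forms (4 - r)"
    show "\<omega> \<in> forms r"
      using formsD[OF *] star_nz eq by (intro formsI) blast
  next
    assume *: "\<omega> \<in> forms r"
    have "cdim (flip4 (unflip4 s)) = 4 - r" if "star \<omega> (flip4 (unflip4 s)) \<noteq> 0" for s
      using formsD[OF *] that star_nz eq by blast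
    then show "star \<omega> \<in> forms (4 - r)"
      by (intro formsI) (simp only: flip4_unflip4)
  qed
qed

lemma codiff_in_forms:
  assumes "\<psi> \<in> forms (Suc r)" "r \<le> 3"
  shows "codiff (Suc r) \<psi> \<in> forms r"
proof -
  have "star \<psi> \<in> forms (3 - r)" using star_in_forms_iff[of "Suc r" \<psi>] assms by simp
  then have "dc (star \<psi>) \<in> forms (4 - r)" using dc_in_forms[of "star \<psi>" "3 - r"] assms(2)
    by (simp flip: Suc_diff_le)
  then have "inv star (dc (star \<psi>)) \<in> forms r"
    using star_in_forms_iff[of r "inv star (dc (star \<psi>))"] assms(2)
    by (simp add: surj_f_inv_f[OF bij_is_surj[OF bij_star]])
  then show ?thesis
    by (intro formsI) (auto simp: scale_form_def dest: formsD)
qed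

end

theory Submission
  imports Defs
begin

text \<open>
  The Leibniz rule for the boundary gives \<open>d\<^sup>c d\<^sup>c = 0\<close> by induction over the tensor factors, and
  conjugation with the star operator gives \<open>\<delta>\<^sup>c \<delta>\<^sup>c = 0\<close>.  Hence, by linearity, the transformation
  changes the left-hand sides of the second and fourth equations of the system by
  \<open>\<Delta>\<^sup>c \<phi>\<^sub>1 = 0\<close> and \<open>\<Delta>\<^sup>c \<phi>\<^sub>3 = 0\<close>; the other equations do not involve the transformed forms.
\<close>

lemma pairing_form_add: "pairing a (\<omega> + \<eta>) = pairing a \<omega> + pairing a \<eta>"
  by (simp add: pairing_def distrib_left sum.distrib)

lemma pairing_form_diff: "pairing a (\<omega> - \<eta>) = pairing a \<omega> - pairing a \<eta>"
  by (simp add: pairing_def right_diff_distrib sum_subtractf)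

lemma pairing_form_scale: "pairing a (\<lambda>s. c * \<omega> s) = c * pairing a \<omega>"
  by (simp add: pairing_def sum_distrib_left mult.left_commute)

lemma pairing_cong:
  "(\<And>s. s \<in> Poly_Mapping.keys a \<Longrightarrow> \<omega> s = \<eta> s) \<Longrightarrow> pairing a \<omega> = pairing a \<eta>"
  by (simp add: pairing_def)

text \<open>Chains have finite support, so both pairings are finite sums and can be
  interchanged.\<close>

lemma pairing_swap:
  "pairing a (\<lambda>s. pairing b (\<lambda>t. \<omega> s t)) = pairing b (\<lambda>t. pairing a (\<lambda>s. \<omega> s t))"
  unfolding pairing_def sum_distrib_left
  by (subst sum.swap) (simp add: mult.left_commute)

lemma pairing_tensor_chain:
  "pairing (tensor_chain a b) \<omega> = pairing a (\<lambda>s. pairing b (\<lambda>t. \<omega> (s, t)))"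
  by (simp add: tensor_chain_def pairing_sum pairing_single)
     (simp add: pairing_def sum_distrib_left mult.assoc)

text \<open>The Leibniz rule read through the pairing: only boundaries of single factors remain,
  paired with slices of \<open>\<omega>\<close>.\<close>

lemma pairing_bd_prod:
  "pairing (bd (s, t)) \<omega> =
     pairing (bd s) (\<lambda>s'. \<omega> (s', t)) + (-1) ^ cdim s * pairing (bd t) (\<lambda>t'. \<omega> (s, t'))"
  by (simp add: pairing_add pairing_scale pairing_tensor_chain pairing_single)

text \<open>Only an edge has a nonzero boundary, and that consists of points, whose boundary is
  zero.\<close>

lemma pairing_bd_bd_cell: "pairing (bd (s :: cell)) (\<lambda>t. pairing (bd t) \<omega>) = 0"
proof -
  have "pairing (bd t) \<omega> = 0" if "t \<in> Poly_Mapping.keys (bd s)" for t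
    using cdim_bd_cell[OF that] by (cases s; cases t) (auto simp: pairing_zero)
  then show ?thesis by (simp add: pairing_def)
qed

text \<open>
  The mixed terms cancel because the boundary lowers the dimension of the first factor by one,
  which flips the sign in the Leibniz rule.
\<close>

lemma pairing_bd_bd_prod:
  fixes s :: "'a::tensor_basis \<times> 'b::tensor_basis"
  assumes dim: "\<And>(u::'a) v. v \<in> Poly_Mapping.keys (bd u) \<Longrightarrow> Suc (cdim v) = cdim u"
    and a: "\<And>(u::'a) \<omega>. pairing (bd u) (\<lambda>v. pairing (bd v) \<omega>) = 0"
    and b: "\<And>(u::'b) \<omega>. pairing (bd u) (\<lambda>v. pairing (bd v) \<omega>) = 0"
  shows "pairing (bd s) (\<lambda>t. pairing (bd t) \<omega>) = 0"
proof -
  obtain u v where s: "s = (u, v)" by (cases s)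
  let ?mixed = "pairing (bd u) (\<lambda>u'. pairing (bd v) (\<lambda>v'. \<omega> (u', v')))"
  have "pairing (bd u) (\<lambda>u'. pairing (bd (u', v)) \<omega>) =
      pairing (bd u) ((\<lambda>u'. pairing (bd u') (\<lambda>u''. \<omega> (u'', v))) +
        (\<lambda>u'. - ((-1) ^ cdim u) * pairing (bd v) (\<lambda>v'. \<omega> (u', v'))))"
    by (rule pairing_cong) (simp add: pairing_bd_prod del: bd_prod.simps flip: dim)
  also have "\<dots> = - ((-1) ^ cdim u) * ?mixed"
    by (simp only: pairing_form_add pairing_form_scale a add_0_left)
  finally have left: "pairing (bd u) (\<lambda>u'. pairing (bd (u', v)) \<omega>) = - ((-1) ^ cdim u) * ?mixed" .
  have "pairing (bd v) (\<lambda>v'. pairing (bd (u, v')) \<omega>) =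
      pairing (bd v) ((\<lambda>v'. pairing (bd u) (\<lambda>u'. \<omega> (u', v'))) +
        (\<lambda>v'. (-1) ^ cdim u * pairing (bd v') (\<lambda>v''. \<omega> (u, v''))))"
    by (rule pairing_cong) (simp add: pairing_bd_prod del: bd_prod.simps)
  also have "\<dots> = ?mixed"
    unfolding pairing_form_add pairing_form_scale b by (subst pairing_swap) simp
  \<comment> \<open>The outer Leibniz rule multiplies this by \<open>(-1) ^ cdim u\<close>, the
    negative of the coefficient of \<open>?mixed\<close> in \<open>left\<close>.\<close>
  finally show ?thesis
    unfolding s pairing_bd_prod[of u v "\<lambda>t. pairing (bd t) \<omega>"] left by simp
qed

lemma dc_dc: "dc (dc \<omega>) = 0"
proof -
  have 2: "pairing (bd u) (\<lambda>v. pairing (bd v) \<eta>) = 0" for u :: "cell \<times> cell" and \<eta>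
    by (intro pairing_bd_bd_prod pairing_bd_bd_cell cdim_bd_cell)
  \<comment> \<open>Each further tensor product asks for the dimension property of its left factor,
    so this is built up alongside.\<close>
  have dim2: "Suc (cdim v) = cdim u" if "v \<in> Poly_Mapping.keys (bd u)" for u v :: "cell \<times> cell"
    using cdim_bd_cell cdim_bd_cell that by (rule cdim_bd_prod)
  have 3: "pairing (bd u) (\<lambda>v. pairing (bd v) \<eta>) = 0" for u :: "(cell \<times> cell) \<times> cell" and \<eta>
    by (intro pairing_bd_bd_prod 2 pairing_bd_bd_cell dim2)
  have dim3: "Suc (cdim v) = cdim u" if "v \<in> Poly_Mapping.keys (bd u)"
    for u v :: "(cell \<times> cell) \<times> cell"
    using dim2 cdim_bd_cell that by (rule cdim_bd_prod)
  have "pairing (bd u) (\<lambda>v. pairing (bd v) \<omega>) = 0" for u :: cell4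
    by (intro pairing_bd_bd_prod 3 pairing_bd_bd_cell dim3)
  then show ?thesis by (simp add: dc_apply fun_eq_iff)
qed

lemma dc_add: "dc (\<omega> + \<eta>) = dc \<omega> + dc \<eta>"
  by (simp add: dc_apply fun_eq_iff pairing_form_add)

lemma dc_diff: "dc (\<omega> - \<eta>) = dc \<omega> - dc \<eta>"
  by (simp add: dc_apply fun_eq_iff pairing_form_diff)

lemma dc_scale: "dc (scale_form c \<omega>) = scale_form c (dc \<omega>)"
  by (simp add: dc_apply scale_form_def fun_eq_iff pairing_form_scale)

text \<open>\<open>star\<close> moves the coefficient at \<open>s\<close> to \<open>flip4 s\<close>
  with a sign of square 1, so the inverse reads it back with the same sign.\<close>

lemma inv_star_apply: "inv star \<omega> s = star_sign s * \<omega> (flip4 s)"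
proof -
  have "star (\<lambda>s. star_sign s * \<omega> (flip4 s)) = \<omega>"
    by (simp add: fun_eq_iff star_apply flip: mult.assoc)
  then have "inv star \<omega> = (\<lambda>s. star_sign s * \<omega> (flip4 s))"
    by (metis bij_star bij_is_inj inv_f_f)
  then show ?thesis by simp
qed

lemma star_add: "star (\<omega> + \<eta>) = star \<omega> + star \<eta>"
  by (simp add: fun_eq_iff star_apply distrib_left)

lemma star_diff: "star (\<omega> - \<eta>) = star \<omega> - star \<eta>"
  by (simp add: fun_eq_iff star_apply right_diff_distrib)

lemma star_scale: "star (scale_form c \<omega>) = scale_form c (star \<omega>)"
  by (simp add: fun_eq_iff star_apply scale_form_def mult.left_commute)

lemma codiff_add: "codiff r (\<omega> + \<eta>) = codiff r \<omega> + codiff r \<eta>"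
  by (cases r) (simp_all add: star_add dc_add fun_eq_iff scale_form_def inv_star_apply distrib_left)

lemma codiff_diff: "codiff r (\<omega> - \<eta>) = codiff r \<omega> - codiff r \<eta>"
  by (cases r)
     (simp_all add: star_diff dc_diff fun_eq_iff scale_form_def inv_star_apply right_diff_distrib)

text \<open>The outer \<open>star\<close> cancels the inner \<open>inv star\<close>, leaving a
  multiple of \<open>dc (dc (star \<omega>))\<close>. For \<open>r = 0\<close> the outer operator is
  zero by definition.\<close>

lemma codiff_codiff: "codiff r (codiff (Suc r) \<omega>) = 0"
proof (cases r)
  case (Suc q)
  have "dc (star (codiff (Suc r) \<omega>)) = 0"
    by (simp add: star_scale dc_scale surj_f_inv_f[OF bij_is_surj[OF bij_star]] dc_dc)
       (simp add: scale_form_def fun_eq_iff)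
  then show ?thesis
    by (simp add: Suc fun_eq_iff scale_form_def inv_star_apply del: codiff.simps(2))
       (simp add: scale_form_def inv_star_apply)
qed simp

lemma forms_add: "\<omega> \<in> forms r \<Longrightarrow> \<eta> \<in> forms r \<Longrightarrow> \<omega> + \<eta> \<in> forms r"
  by (rule formsI) (metis plus_fun_apply add_0 formsD)

lemma forms_diff: "\<omega> \<in> forms r \<Longrightarrow> \<eta> \<in> forms r \<Longrightarrow> \<omega> - \<eta> \<in> forms r"
  by (rule formsI) (metis fun_diff_def diff_0_right formsD)

text \<open>The gauge condition in the form used below: the terms that a gauge form adds to the
  degrees below and above its own cancel.\<close>

lemma dc_codiff_harmonic:
  "laplacian r \<phi> = 0 \<Longrightarrow> dc (codiff r \<phi>) = - codiff (Suc r) (dc \<phi>)"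
  by (metis add.inverse_inverse add_eq_0_iff laplacian_def neg_equal_0_iff_equal minus_unique)

theorem proposition6p4:
  fixes m2 :: real
    and \<omega>0 \<omega>1 \<omega>2 \<omega>3 \<omega>4 \<phi>1 \<phi>3 :: "cell4 \<Rightarrow> real"
  assumes "m2 \<noteq> 0"
    and "\<omega>0 \<in> forms 0" and "\<omega>1 \<in> forms 1" and "\<omega>2 \<in> forms 2" and "\<omega>3 \<in> forms 3" and "\<omega>4 \<in> forms 4"
    and "\<phi>1 \<in> forms 1" and "\<phi>3 \<in> forms 3"
    and "laplacian 1 \<phi>1 = 0" and "laplacian 3 \<phi>3 = 0"
  shows "is_solution m2 \<omega>0 \<omega>1 \<omega>2 \<omega>3 \<omega>4 \<longleftrightarrow>
    is_solution m2 (\<omega>0 - codiff 1 \<phi>1) \<omega>1 (\<omega>2 + dc \<phi>1 - codiff 3 \<phi>3) \<omega>3 (\<omega>4 + dc \<phi>3)"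
proof -
  \<comment> \<open>\<open>is_solution\<close> also demands the degrees, so the transformed forms
    must keep theirs.\<close>
  have "codiff 1 \<phi>1 \<in> forms 0" "codiff 3 \<phi>3 \<in> forms 2"
    using codiff_in_forms[of \<phi>1 0] codiff_in_forms[of \<phi>3 2] assms by (simp_all add: numeral_3_eq_3)
  moreover have "dc \<phi>1 \<in> forms 2" "dc \<phi>3 \<in> forms 4"
    using dc_in_forms[of \<phi>1 1] dc_in_forms[of \<phi>3 3] assms by (simp_all add: numeral_2_eq_2)
  ultimately have forms: "\<omega>0 - codiff 1 \<phi>1 \<in> forms 0"
    "\<omega>2 + dc \<phi>1 - codiff 3 \<phi>3 \<in> forms 2" "\<omega>4 + dc \<phi>3 \<in> forms 4"
    using assms by (auto intro: forms_add forms_diff)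
  have "dc (codiff 1 \<phi>1) = - codiff 2 (dc \<phi>1)" "codiff 2 (codiff 3 \<phi>3) = 0"
    using dc_codiff_harmonic[of 1 \<phi>1] codiff_codiff[of 2 \<phi>3] assms by (simp_all add: eval_nat_numeral)
  \<comment> \<open>The two \<open>\<phi>1\<close> terms cancel; \<open>\<phi>3\<close> enters only
    through \<open>codiff 2 (codiff 3 \<phi>3)\<close>.\<close>
  then have eq1: "dc (\<omega>0 - codiff 1 \<phi>1) - codiff 2 (\<omega>2 + dc \<phi>1 - codiff 3 \<phi>3) =
      dc \<omega>0 - codiff 2 \<omega>2"
    by (simp only: dc_diff codiff_add codiff_diff) simp
  have "dc (codiff 3 \<phi>3) = - codiff 4 (dc \<phi>3)"
    using dc_codiff_harmonic[of 3 \<phi>3] assms by (simp add: eval_nat_numeral)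
  \<comment> \<open>Here the \<open>\<phi>3\<close> terms cancel and \<open>\<phi>1\<close> enters
    only through \<open>dc (dc \<phi>1)\<close>.\<close>
  then have eq3: "dc (\<omega>2 + dc \<phi>1 - codiff 3 \<phi>3) - codiff 4 (\<omega>4 + dc \<phi>3) = dc \<omega>2 - codiff 4 \<omega>4"
    by (simp only: dc_diff dc_add dc_dc codiff_add) simp
  show ?thesis
    unfolding is_solution_def eq1 eq3 using assms forms by blast
qed

end
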